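(* Let $(E,\mathcal{C},r_{\mathcal{C}})$ be a semimatroid, $\prec$ a linear ordering of $E$, and $\bm x=\{x_e\}_{e\in E}$ indeterminates. Then \[ Z(\mathcal{C};\lambda,\bm x)=\lambda^{-r(\mathcal{C})}\sum_{B\in\mathscr{B}(\mathcal{C})}\prod_{b\in B}x_b\prod_{e\in {\rm EA}(B)}(x_e+1)\prod_{i\in {\rm IA}(B)}\Big(\frac{\lambda}{x_i}+1\Big). \]
   Context: A semimatroid is a triple $(E,\mathcal{C},r_{\mathcal{C}})$ where $E$ is a finite set, $\mathcal{C}$ is a nonempty simplicial complex on $E$, and $r_{\mathcal{C}}:\mathcal{C}\to\mathbb{N}$ satisfies: (SR1) $0\le r_{\mathcal{C}}(X)\le |X|$; (SR2) $X\subseteq Y$ in $\mathcal{C}$ implies $r_{\mathcal{C}}(X)\le r_{\mathcal{C}}(Y)$; (SR3) if $X,Y,X\cup Y\in\mathcal{C}$ then $r_{\mathcal{C}}(X\cap Y)+r_{\mathcal{C}}(X\cup Y)\le r_{\mathcal{C}}(X)+r_{\mathcal{C}}(Y)$; (SR4) if $X,Y\in\mathcal{C}$ and $r_{\mathcal{C}}(X)=r_{\mathcal{C}}(X\cap Y)$ then $X\cup Y\in\mathcal{C}$; (SR5) if $X,Y\in\mathcal{C}$ and $r_{\mathcal{C}}(X)<r_{\mathcal{C}}(Y)$ then $X\cup\{e\}\in\mathcal{C}$ for some $e\in Y-X$. All maximal members of $\mathcal{C}$ have the same rank, denoted $r(\mathcal{C})$. A central set $X\in\mathcal{C}$ is independent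 if $r_{\mathcal{C}}(X)=|X|$; a basis is a maximal independent central set, and $\mathscr{B}(\mathcal{C})$ is the set of bases; a circuit is a minimal dependent central set. For a basis $B$ and $e\in E-B$ with $B\cup\{e\}\in\mathcal{C}$, $B\cup\{e\}$ contains a unique circuit $C(e,B)$, and it contains $e$; $e$ is externally active for $B$ if such $C(e,B)$ exists and $e$ is its $\prec$-minimal element; ${\rm EA}(B)$ is the set of externally active elements. For $b\in B$, the fundamental cocircuit $C^*(b,B)$ is the unique cocircuit of $\mathcal{C}$ contained in $(E-B)\cup\{b\}$ (equivalently, the set of $f\in E$ such that $(B-\{b\})\cup\{f\}$ is a basis); $b$ is internally active if it is the $\prec$-minimal element of $C^*(b,B)$; ${\rm IA}(B)$ is the set of internally active elements. The multivariate Tutte polynomial is $Z(\mathcal{C};\lambda,\bm x)=\sum_{A\in\mathcal{C}}\lambda^{-r_{\mathcal{C}}(A)}\prod_{e\in A}x_e$. *)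

theory Defs
  imports Main
begin

text \<open>
  A central set is a member of \<open>C\<close>. Elements of \<open>E\<close> lying in no central set are allowed, as
  usual for semimatroids. Only the values of \<open>r\<close> on \<open>C\<close> are relevant.
\<close>

locale semimatroid =
  fixes E :: "'e set" and C :: "'e set set" and r :: "'e set \<Rightarrow> nat"
  assumes finite_ground: "finite E"
    and central_subset: "X \<in> C \<Longrightarrow> X \<subseteq> E"
    and central_nonempty: "C \<noteq> {}"
    and central_down: "X \<in> C \<Longrightarrow> Y \<subseteq> X \<Longrightarrow> Y \<in> C"
    and SR1: "X \<in> C \<Longrightarrow> 0 \<le> r X \<and> r X \<le> card X"
    and SR2: "X \<in> C \<Longrightarrow> Y \<in> C \<Longrightarrow> X \<subseteq> Y \<Longrightarrow> r X \<le> r Y"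
    and SR3: "X \<in> C \<Longrightarrow> Y \<in> C \<Longrightarrow> X \<union> Y \<in> C \<Longrightarrow> r (X \<inter> Y) + r (X \<union> Y) \<le> r X + r Y"
    and SR4: "X \<in> C \<Longrightarrow> Y \<in> C \<Longrightarrow> r X = r (X \<inter> Y) \<Longrightarrow> X \<union> Y \<in> C"
    and SR5: "X \<in> C \<Longrightarrow> Y \<in> C \<Longrightarrow> r X < r Y \<Longrightarrow> \<exists>e\<in>Y - X. X \<union> {e} \<in> C"

definition maximal_in :: "'e set set \<Rightarrow> 'e set \<Rightarrow> bool" where
  "maximal_in \<F> X \<longleftrightarrow> X \<in> \<F> \<and> (\<forall>Y\<in>\<F>. X \<subseteq> Y \<longrightarrow> Y = X)"

definition minimal_in :: "'e set set \<Rightarrow> 'e set \<Rightarrow> bool" where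
  "minimal_in \<F> X \<longleftrightarrow> X \<in> \<F> \<and> (\<forall>Y\<in>\<F>. Y \<subseteq> X \<longrightarrow> Y = X)"

definition total_rank :: "'e set set \<Rightarrow> ('e set \<Rightarrow> nat) \<Rightarrow> nat" where
  "total_rank C r = (THE k. \<forall>X. maximal_in C X \<longrightarrow> r X = k)"

definition independents :: "'e set set \<Rightarrow> ('e set \<Rightarrow> nat) \<Rightarrow> 'e set set" where
  "independents C r = {X \<in> C. r X = card X}"

definition bases :: "'e set set \<Rightarrow> ('e set \<Rightarrow> nat) \<Rightarrow> 'e set set" where
  "bases C r = {B. maximal_in (independents C r) B}"

definition circuits :: "'e set set \<Rightarrow> ('e set \<Rightarrow> nat) \<Rightarrow> 'e set set" where
  "circuits C r = {D. minimal_in (C - independents C r) D}"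

definition deletion :: "'e set set \<Rightarrow> 'e set \<Rightarrow> 'e set set" where
  "deletion C D = {X \<in> C. X \<inter> D = {}}"

text \<open>
  A cocircuit is a minimal subset of \<open>E\<close> whose deletion lowers the rank of the semimatroid
  (Ardila's definition).
\<close>

definition cocircuits :: "'e set \<Rightarrow> 'e set set \<Rightarrow> ('e set \<Rightarrow> nat) \<Rightarrow> 'e set set" where
  "cocircuits E C r =
     {D. minimal_in {D. D \<subseteq> E \<and> total_rank (deletion C D) r < total_rank C r} D}"

definition fundamental_circuit :: "'e set set \<Rightarrow> ('e set \<Rightarrow> nat) \<Rightarrow> 'e \<Rightarrow> 'e set \<Rightarrow> 'e set" where
  "fundamental_circuit C r e B = (THE D. D \<in> circuits C r \<and> D \<subseteq> B \<union> {e})"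

definition fundamental_cocircuit ::
    "'e set \<Rightarrow> 'e set set \<Rightarrow> ('e set \<Rightarrow> nat) \<Rightarrow> 'e \<Rightarrow> 'e set \<Rightarrow> 'e set" where
  "fundamental_cocircuit E C r b B = (THE D. D \<in> cocircuits E C r \<and> D \<subseteq> (E - B) \<union> {b})"

text \<open>Orders are strict: \<open>(e, f) \<in> R\<close> means \<open>e \<prec> f\<close>.\<close>

definition order_minimal :: "('e \<times> 'e) set \<Rightarrow> 'e set \<Rightarrow> 'e \<Rightarrow> bool" where
  "order_minimal R S e \<longleftrightarrow> e \<in> S \<and> (\<forall>f\<in>S. (f, e) \<notin> R)"

definition externally_active ::
    "'e set \<Rightarrow> 'e set set \<Rightarrow> ('e set \<Rightarrow> nat) \<Rightarrow> ('e \<times> 'e) set \<Rightarrow> 'e set \<Rightarrow> 'e set" where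
  "externally_active E C r R B =
     {e \<in> E - B. B \<union> {e} \<in> C \<and> order_minimal R (fundamental_circuit C r e B) e}"

definition internally_active ::
    "'e set \<Rightarrow> 'e set set \<Rightarrow> ('e set \<Rightarrow> nat) \<Rightarrow> ('e \<times> 'e) set \<Rightarrow> 'e set \<Rightarrow> 'e set" where
  "internally_active E C r R B =
     {b \<in> B. order_minimal R (fundamental_cocircuit E C r b B) b}"

text \<open>
  The indeterminates are represented by arbitrary nonzero elements of an arbitrary field; the
  formal identity is the case of a field of rational functions.
\<close>

definition multivariate_tutte ::
    "'e set set \<Rightarrow> ('e set \<Rightarrow> nat) \<Rightarrow> 'a::field \<Rightarrow> ('e \<Rightarrow> 'a) \<Rightarrow> 'a" where
  "multivariate_tutte C r lam x = (\<Sum>A\<in>C. lam powi (- int (r A)) * (\<Prod>e\<in>A. x e))"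


text \<open>
  The definite descriptions above are well defined, and the fundamental cocircuit is the set of
  elements that can replace \<open>b\<close> in \<open>B\<close>.
\<close>

context semimatroid
begin

lemma central_finite: "X \<in> C \<Longrightarrow> finite X"
  using central_subset finite_ground finite_subset by blast

lemma finite_central: "finite C"
proof (rule finite_subset)
  show "C \<subseteq> Pow E" using central_subset by blast
qed (simp add: finite_ground)

lemma empty_central: "{} \<in> C"
  using central_nonempty central_down by blast

lemma rank_empty: "r {} = 0"
  using SR1[OF empty_central] by simp

lemma maximal_same_rank:
  assumes "maximal_in C X" "maximal_in C Y"
  shows "r X = r Y"
proof -
  have "\<not> r X < r Y" if max: "maximal_in C X" "maximal_in C Y" for X Y
  proof
    assume "r X < r Y"
    then obtain e where "e \<in> Y - X" "X \<union> {e} \<in> C"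
      using SR5[of X Y] max unfolding maximal_in_def by blast
    then show False using max(1) unfolding maximal_in_def by blast
  qed
  then show ?thesis using assms by (metis linorder_neqE_nat)
qed

lemma central_in_maximal:
  assumes "\<F> \<subseteq> C" "X \<in> \<F>"
  obtains M where "maximal_in \<F> M" "X \<subseteq> M"
proof -
  have "finite \<F>" using assms finite_central finite_subset by blast
  from finite_has_maximal2[OF this assms(2)] obtain M where
    M: "M \<in> \<F>" "X \<subseteq> M" "\<forall>b\<in>\<F>. M \<subseteq> b \<longrightarrow> M = b" by auto
  then have "maximal_in \<F> M" unfolding maximal_in_def by blast
  then show thesis using M(2) by (rule that)
qed

lemma total_rank_maximal:
  assumes "maximal_in C X"
  shows "total_rank C r = r X"
  unfolding total_rank_def
proof (rule the_equality)
  show "\<forall>Y. maximal_in C Y \<longrightarrow> r Y = r X" using maximal_same_rank assms by blast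
qed (use assms in auto)

lemma rank_le_total:
  assumes "X \<in> C"
  shows "r X \<le> total_rank C r"
proof -
  obtain M where M: "maximal_in C M" "X \<subseteq> M" using central_in_maximal[OF subset_refl assms] .
  then have "r X \<le> r M" using SR2 assms unfolding maximal_in_def by blast
  then show ?thesis using total_rank_maximal M by simp
qed

lemma total_rank_attained: obtains X where "X \<in> C" "r X = total_rank C r"
proof -
  obtain M where M: "maximal_in C M" using central_in_maximal[OF subset_refl empty_central] by blast
  then have "M \<in> C" "r M = total_rank C r"
    by (simp_all add: maximal_in_def total_rank_maximal)
  then show thesis by (rule that)
qed

lemma rank_insert_le:
  assumes "X \<union> {e} \<in> C"
  shows "r (X \<union> {e}) \<le> r X + 1"
proof -
  have c: "X \<in> C" "{e} \<in> C" "X \<inter> {e} \<in> C" using assms central_down by blast+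
  have "r {e} \<le> 1" using SR1[OF c(2)] by simp
  then show ?thesis using SR3[OF c(1,2) assms] by linarith
qed

lemma augment:
  assumes X: "X \<in> C" and Y: "Y \<in> C" and less: "r X < r Y"
  obtains (augmenting) e where "e \<in> Y - X" "X \<union> {e} \<in> C" "r (X \<union> {e}) = r X + 1"
proof (rule ccontr)
  assume neg: "\<not> thesis"
  have no: "r (X \<union> {e}) = r X" if e: "e \<in> Y - X" "X \<union> {e} \<in> C" for e
  proof -
    have "r (X \<union> {e}) \<noteq> r X + 1" using neg augmenting[OF e] by blast
    moreover have "r X \<le> r (X \<union> {e})" by (rule SR2[OF X e(2)]) blast
    ultimately show ?thesis using rank_insert_le[OF e(2)] by linarith
  qed
  define S where "S = {e \<in> Y - X. X \<union> {e} \<in> C}"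
  have "finite S" unfolding S_def using central_finite[OF Y] by auto
  then have finT: "finite T" if "T \<subseteq> S" for T using that finite_subset by blast
  have ext: "X \<union> T \<in> C \<and> r (X \<union> T) = r X" if "T \<subseteq> S" for T
    using finT[OF that] that
  proof (induction T rule: finite_induct)
    case empty
    then show ?case using X by simp
  next
    case (insert e T)
    have IH: "X \<union> T \<in> C" "r (X \<union> T) = r X" using insert by auto
    have e: "e \<in> Y - X" "X \<union> {e} \<in> C" "r (X \<union> {e}) = r X"
      using insert no unfolding S_def by auto
    have int: "(X \<union> {e}) \<inter> (X \<union> T) = X" using insert e by blast
    have un: "(X \<union> {e}) \<union> (X \<union> T) = X \<union> insert e T" by blast
    have in': "X \<union> insert e T \<in> C"
      using SR4[OF e(2) IH(1)] e(3) unfolding int un by simp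
    have "r (X \<union> insert e T) \<le> r X"
      using SR3[OF e(2) IH(1)] in' e(3) IH(2) unfolding int un by simp
    moreover have "r X \<le> r (X \<union> insert e T)" by (rule SR2[OF X in']) blast
    ultimately show ?case using in' by simp
  qed
  have XS: "X \<union> S \<in> C" "r (X \<union> S) = r X" using ext by auto
  then obtain e where e: "e \<in> Y - (X \<union> S)" "(X \<union> S) \<union> {e} \<in> C"
    using SR5[OF XS(1) Y] less by auto
  have "X \<union> {e} \<in> C" by (rule central_down[OF e(2)]) blast
  then show False using e unfolding S_def by blast
qed

lemma independent_subset:
  assumes "X \<in> independents C r" "Y \<subseteq> X"
  shows "Y \<in> independents C r"
proof -
  have X: "X \<in> C" "r X = card X" using assms unfolding independents_def by auto
  have Y: "Y \<in> C" "X - Y \<in> C" using X assms central_down by blast+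
  have "Y \<union> (X - Y) = X" "Y \<inter> (X - Y) = {}" using assms by auto
  then have "card X \<le> r Y + r (X - Y)"
    using SR3[OF Y] X by (simp add: rank_empty)
  moreover have "card X = card Y + card (X - Y)"
    using assms central_finite[OF X(1)]
    by (simp add: card_Diff_subset card_mono finite_subset)
  ultimately show ?thesis using SR1[OF Y(1)] SR1[OF Y(2)] Y unfolding independents_def by auto
qed

lemma bases_iff: "B \<in> bases C r \<longleftrightarrow> B \<in> independents C r \<and> card B = total_rank C r"
proof
  assume B: "B \<in> bases C r"
  then have i: "B \<in> independents C r" and c: "B \<in> C" "r B = card B"
    unfolding bases_def maximal_in_def independents_def by auto
  have "\<not> r B < total_rank C r"
  proof
    assume less: "r B < total_rank C r"
    obtain X where "X \<in> C" "r X = total_rank C r" by (rule total_rank_attained)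
    then obtain e where e: "e \<in> X - B" "B \<union> {e} \<in> C" "r (B \<union> {e}) = r B + 1"
      using augment[OF c(1)] less by metis
    then have "B \<union> {e} \<in> independents C r"
      using c central_finite[OF c(1)] unfolding independents_def by auto
    then show False using B e unfolding bases_def maximal_in_def by blast
  qed
  then show "B \<in> independents C r \<and> card B = total_rank C r"
    using rank_le_total[OF c(1)] c i by simp
next
  assume B: "B \<in> independents C r \<and> card B = total_rank C r"
  have "Y = B" if "Y \<in> independents C r" "B \<subseteq> Y" for Y
  proof -
    have "Y \<in> C" "r Y = card Y" using that unfolding independents_def by auto
    then have "card Y \<le> card B" "finite Y" using B rank_le_total[of Y] central_finite by auto
    then show ?thesis using that by (metis card_seteq)
  qed
  then show "B \<in> bases C r" using B unfolding bases_def maximal_in_def by blast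
qed

lemma bases_nonempty: "bases C r \<noteq> {}"
proof -
  have "{} \<in> independents C r" using empty_central rank_empty unfolding independents_def by simp
  moreover have "independents C r \<subseteq> C" unfolding independents_def by auto
  ultimately obtain B where "maximal_in (independents C r) B" using central_in_maximal by blast
  then show ?thesis unfolding bases_def by blast
qed

lemma semimatroid_deletion: "semimatroid E (deletion C D) r"
proof
  fix X Y
  show "finite E" by (rule finite_ground)
  show "deletion C D \<noteq> {}" using empty_central unfolding deletion_def by blast
  show "X \<subseteq> E" if "X \<in> deletion C D"
    using that central_subset[of X] unfolding deletion_def by simp
  show "Y \<in> deletion C D" if "X \<in> deletion C D" "Y \<subseteq> X"
    using that central_down[of X Y] unfolding deletion_def by blast
  show "0 \<le> r X \<and> r X \<le> card X" if "X \<in> deletion C D"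
    using that SR1[of X] unfolding deletion_def by simp
  show "r X \<le> r Y" if "X \<in> deletion C D" "Y \<in> deletion C D" "X \<subseteq> Y"
    using that SR2[of X Y] unfolding deletion_def by simp
  show "r (X \<inter> Y) + r (X \<union> Y) \<le> r X + r Y"
    if "X \<in> deletion C D" "Y \<in> deletion C D" "X \<union> Y \<in> deletion C D"
    using that SR3[of X Y] unfolding deletion_def by simp
  show "X \<union> Y \<in> deletion C D"
    if "X \<in> deletion C D" "Y \<in> deletion C D" "r X = r (X \<inter> Y)"
    using that SR4[of X Y] unfolding deletion_def by (simp add: Int_Un_distrib2)
  show "\<exists>e\<in>Y - X. X \<union> {e} \<in> deletion C D"
    if XY: "X \<in> deletion C D" "Y \<in> deletion C D" "r X < r Y"
  proof -
    obtain e where "e \<in> Y - X" "X \<union> {e} \<in> C"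
      using XY SR5[of X Y] unfolding deletion_def by auto
    then show ?thesis using XY unfolding deletion_def by blast
  qed
qed

lemma deletion_drops_rank_iff:
  "total_rank (deletion C D) r < total_rank C r \<longleftrightarrow> (\<forall>B\<in>bases C r. B \<inter> D \<noteq> {})"
proof -
  interpret del: semimatroid E "deletion C D" r by (rule semimatroid_deletion)
  have le: "total_rank (deletion C D) r \<le> total_rank C r"
  proof -
    obtain X where "X \<in> deletion C D" "r X = total_rank (deletion C D) r"
      by (rule del.total_rank_attained)
    then show ?thesis using rank_le_total[of X] unfolding deletion_def by simp
  qed
  have "total_rank C r \<le> total_rank (deletion C D) r" if "B \<in> bases C r" "B \<inter> D = {}" for B
  proof -
    have "B \<in> deletion C D" "r B = total_rank C r"
      using that bases_iff[of B] unfolding deletion_def independents_def by auto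
    then show ?thesis using del.rank_le_total[of B] by simp
  qed
  moreover have "\<exists>B\<in>bases C r. B \<inter> D = {}" if "total_rank C r = total_rank (deletion C D) r"
  proof -
    obtain B where "B \<in> bases (deletion C D) r" using del.bases_nonempty by blast
    then have "B \<in> independents (deletion C D) r" "card B = total_rank C r"
      using del.bases_iff that by auto
    then have "B \<in> bases C r" "B \<inter> D = {}"
      unfolding bases_iff independents_def deletion_def by auto
    then show ?thesis by blast
  qed
  ultimately show ?thesis using le by (metis leD le_neq_implies_less)
qed

lemma fundamental_circuit_ex1:
  assumes B: "B \<in> bases C r" and e: "e \<in> E - B" "B \<union> {e} \<in> C"
  shows "\<exists>!D. D \<in> circuits C r \<and> D \<subseteq> B \<union> {e}"
    and "D \<in> circuits C r \<Longrightarrow> D \<subseteq> B \<union> {e} \<Longrightarrow> e \<in> D"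
proof -
  have ind: "B \<in> independents C r" using B bases_iff by blast
  have circ: "D \<in> C \<and> D \<notin> independents C r \<and> (\<forall>Y. Y \<subset> D \<longrightarrow> Y \<in> independents C r)"
    if "D \<in> circuits C r" for D
    using that central_down unfolding circuits_def minimal_in_def by blast
  show mem: "e \<in> D" if "D \<in> circuits C r" "D \<subseteq> B \<union> {e}" for D
    using circ[OF that(1)] that(2) independent_subset[OF ind, of D] by blast
  have dep: "B \<union> {e} \<in> C - independents C r"
    using B e unfolding bases_def maximal_in_def by blast
  have fin: "finite {D \<in> C - independents C r. D \<subseteq> B \<union> {e}}" using finite_central by simp
  have "B \<union> {e} \<in> {D \<in> C - independents C r. D \<subseteq> B \<union> {e}}" using dep by simp
  from finite_has_minimal2[OF fin this] obtain D where
    D: "D \<in> C - independents C r" "D \<subseteq> B \<union> {e}"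
      "\<forall>D'\<in>{D \<in> C - independents C r. D \<subseteq> B \<union> {e}}. D' \<subseteq> D \<longrightarrow> D = D'" by auto
  then have Dc: "D \<in> circuits C r" unfolding circuits_def minimal_in_def by blast
  have "D1 = D2" if D1: "D1 \<in> circuits C r" "D1 \<subseteq> B \<union> {e}"
      and D2: "D2 \<in> circuits C r" "D2 \<subseteq> B \<union> {e}" for D1 D2
  proof (rule ccontr)
    assume neq: "D1 \<noteq> D2"
    have c: "D1 \<in> C" "D2 \<in> C" "D1 \<union> D2 \<in> C"
      using circ D1 D2 central_down[OF e(2)] by auto
    then have f: "finite D1" "finite D2" using central_finite by auto
    have "\<not> D1 \<subset> D2" using circ[OF D1(1)] circ[OF D2(1)] by blast
    then have "D1 \<inter> D2 \<subset> D1" using neq by blast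
    then have "D1 \<inter> D2 \<in> independents C r" using circ[OF D1(1)] by blast
    then have i: "r (D1 \<inter> D2) = card (D1 \<inter> D2)" unfolding independents_def by simp
    have "r D1 \<noteq> card D1" "r D2 \<noteq> card D2"
      using circ[OF D1(1)] circ[OF D2(1)] unfolding independents_def by blast+
    then have "r D1 < card D1" "r D2 < card D2"
      using SR1[OF c(1)] SR1[OF c(2)] by linarith+
    moreover have "card (D1 \<union> D2) + card (D1 \<inter> D2) = card D1 + card D2"
      using card_Un_Int[OF f] by simp
    ultimately have "r (D1 \<union> D2) + 2 \<le> card (D1 \<union> D2)" using SR3[OF c] i by linarith
    moreover have "D1 \<union> D2 - {e} \<subseteq> B" using D1 D2 by blast
    then have "D1 \<union> D2 - {e} \<in> independents C r" by (rule independent_subset[OF ind])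
    then have rem: "r (D1 \<union> D2 - {e}) = card (D1 \<union> D2 - {e})" "D1 \<union> D2 - {e} \<in> C"
      unfolding independents_def by auto
    moreover have "r (D1 \<union> D2 - {e}) \<le> r (D1 \<union> D2)"
      by (rule SR2[OF rem(2) c(3)]) blast
    moreover have "card (D1 \<union> D2 - {e}) = card (D1 \<union> D2) - 1"
      using mem[OF D1] f by (simp add: card_Diff_singleton)
    ultimately show False by linarith
  qed
  then show "\<exists>!D. D \<in> circuits C r \<and> D \<subseteq> B \<union> {e}" using Dc D(2) by blast
qed

lemma fundamental_cocircuit_unique:
  assumes B: "B \<in> bases C r" and b: "b \<in> B"
  shows "D \<in> cocircuits E C r \<and> D \<subseteq> (E - B) \<union> {b} \<longleftrightarrow>
    D = {f \<in> E. (B - {b}) \<union> {f} \<in> bases C r}"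
proof -
  define F where "F = {f \<in> E. (B - {b}) \<union> {f} \<in> bases C r}"
  have i: "B \<in> independents C r" and cB: "card B = total_rank C r" using B bases_iff by auto
  then have BC: "B \<in> C" "finite B" using central_finite unfolding independents_def by auto
  have card: "card (B - {b}) < card B" by (rule card_Diff1_less[OF BC(2) b])
  have FE: "F \<subseteq> (E - B) \<union> {b}"
  proof
    fix f assume f: "f \<in> F"
    have "card ((B - {b}) \<union> {f}) = card B" using f cB bases_iff unfolding F_def by auto
    then have "f \<notin> B - {b}" using card by (metis Un_insert_right insert_absorb less_irrefl sup_bot_right)
    then show "f \<in> (E - B) \<union> {b}" using f unfolding F_def by blast
  qed
  have hits: "B' \<inter> F \<noteq> {}" if B': "B' \<in> bases C r" for B'
  proof -
    have sub: "B - {b} \<in> C" "r (B - {b}) = card (B - {b})"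
      using independent_subset[OF i, of "B - {b}"] unfolding independents_def by auto
    have B'c: "B' \<in> C" "r B' = card B" using B' cB bases_iff unfolding independents_def by auto
    obtain f where f: "f \<in> B' - (B - {b})" "(B - {b}) \<union> {f} \<in> C"
        "r ((B - {b}) \<union> {f}) = r (B - {b}) + 1"
      using augment[OF sub(1) B'c(1)] card sub B'c by metis
    have "card ((B - {b}) \<union> {f}) = card (B - {b}) + 1" using f(1) BC(2) by simp
    moreover have "card (B - {b}) + 1 = card B" using b BC(2)
      by (metis Suc_eq_plus1 card.remove)
    ultimately have "(B - {b}) \<union> {f} \<in> bases C r"
      using f sub cB unfolding bases_iff independents_def by simp
    moreover have "f \<in> E" using f(1) B'c(1) central_subset by blast
    ultimately show ?thesis using f(1) unfolding F_def by blast
  qed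
  have least: "F \<subseteq> D'" if "D' \<subseteq> (E - B) \<union> {b}" "\<forall>B'\<in>bases C r. B' \<inter> D' \<noteq> {}" for D'
  proof
    fix f assume "f \<in> F"
    then have "((B - {b}) \<union> {f}) \<inter> D' \<noteq> {}" using that(2) unfolding F_def by blast
    then show "f \<in> D'" using that(1) b by blast
  qed
  define M where "M = {D. D \<subseteq> E \<and> total_rank (deletion C D) r < total_rank C r}"
  have M_iff: "D' \<in> M \<longleftrightarrow> D' \<subseteq> E \<and> (\<forall>B'\<in>bases C r. B' \<inter> D' \<noteq> {})" for D'
    unfolding M_def deletion_drops_rank_iff by simp
  have co_iff: "D' \<in> cocircuits E C r \<longleftrightarrow> D' \<in> M \<and> (\<forall>Y\<in>M. Y \<subseteq> D' \<longrightarrow> Y = D')" for D'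
    unfolding cocircuits_def minimal_in_def M_def by simp
  have "F \<subseteq> E" unfolding F_def by blast
  then have FM: "F \<in> M" using hits unfolding M_iff by simp
  have min: "F \<subseteq> Y" if "Y \<in> M" "Y \<subseteq> (E - B) \<union> {b}" for Y
    using least[OF that(2)] that(1) unfolding M_iff by simp
  have "F \<in> cocircuits E C r"
    unfolding co_iff
  proof (intro conjI ballI impI FM)
    fix Y assume Y: "Y \<in> M" "Y \<subseteq> F"
    then have "F \<subseteq> Y" using min FE by (meson subset_trans)
    then show "Y = F" using Y(2) by (rule subset_antisym[rotated])
  qed
  moreover have "D = F" if D: "D \<in> cocircuits E C r" "D \<subseteq> (E - B) \<union> {b}" for D
  proof -
    have "D \<in> M" using D(1) unfolding co_iff by simp
    then have "F \<subseteq> D" using min D(2) by simp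
    then have "F = D" using D(1) FM unfolding co_iff by simp
    then show ?thesis by simp
  qed
  ultimately show ?thesis using FE unfolding F_def by blast
qed

lemma fundamental_cocircuit_eq:
  assumes "B \<in> bases C r" "b \<in> B"
  shows "fundamental_cocircuit E C r b B = {f \<in> E. (B - {b}) \<union> {f} \<in> bases C r}"
  unfolding fundamental_cocircuit_def fundamental_cocircuit_unique[OF assms] by simp

end

end

(* Fix a central set A and order E so that the elements of A come first, in decreasing order,
   followed by the elements outside A, in increasing order. A basis B satisfies
   B - IA(B) <= A <= B Un EA(B) if and only if no exchange of one element improves B in this
   order, and exactly one basis has this property (greedy argument). Hence the central sets are
   partitioned into the intervals [B - IA(B), B Un EA(B)] (Crapo). On such an interval the rank
   of A is card (A Int B), so the sum over the interval factors as the summand of B. *)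
theory Submission
  imports Defs
begin

section \<open>The sum over a single interval\<close>

text \<open>A member of the interval arises from \<open>B\<close> by removing any \<open>J\<close>
  \<subseteq> \<open>I\<close> and adding any \<open>G\<close> \<subseteq> \<open>F\<close>,
  independently. The sum therefore splits into a product of two sums over subsets, each the
  expansion of a product of binomials.\<close>

lemma sum_activity_interval:
  fixes lam :: "'a::field" and x :: "'e \<Rightarrow> 'a"
  assumes fin: "finite B" "finite F" and disj: "F \<inter> B = {}" and IB: "I \<subseteq> B"
    and lam: "lam \<noteq> 0" and x: "\<And>b. b \<in> B \<Longrightarrow> x b \<noteq> 0"
  shows "(\<Sum>A\<in>{B - I..B \<union> F}. lam powi (- int (card (A \<inter> B))) * (\<Prod>e\<in>A. x e)) =
    lam powi (- int (card B)) *
      ((\<Prod>b\<in>B. x b) * (\<Prod>e\<in>F. x e + 1) * (\<Prod>i\<in>I. lam / x i + 1))"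
proof -
  have fI: "finite I" using IB fin finite_subset by blast
  have bij: "bij_betw (\<lambda>(G, J). (B - J) \<union> G) (Pow F \<times> Pow I) {B - I..B \<union> F}"
    by (rule bij_betw_byWitness[where f' = "\<lambda>A. (A - B, B - A)"]) (use disj IB in auto)
  \<comment> \<open>Removing \<open>J\<close> raises the exponent of \<open>lam\<close> by
    \<open>card J\<close> and drops the factors \<open>x i\<close> for \<open>i\<close> in
    \<open>J\<close>, so each removed element contributes \<open>lam / x i\<close>.\<close>
  have summand: "lam powi (- int (card (((B - J) \<union> G) \<inter> B))) * (\<Prod>e\<in>(B - J) \<union> G. x e) =
      lam powi (- int (card B)) * (\<Prod>b\<in>B. x b) * ((\<Prod>e\<in>G. x e) * (\<Prod>i\<in>J. lam / x i))"
    if G: "G \<subseteq> F" and J: "J \<subseteq> I" for G J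
  proof -
    have f: "finite G" "finite J" using G J fin fI finite_subset by blast+
    have JB: "J \<subseteq> B" using J IB by blast
    have "((B - J) \<union> G) \<inter> B = B - J" using G disj by blast
    then have "- int (card (((B - J) \<union> G) \<inter> B)) = - int (card B) + int (card J)"
      using card_Diff_subset[OF f(2) JB] card_mono[OF fin(1) JB] by simp
    then have p: "lam powi (- int (card (((B - J) \<union> G) \<inter> B))) =
        lam powi (- int (card B)) * lam ^ card J"
      using lam by (simp only: power_int_add power_int_of_nat simp_thms)
    have "(\<Prod>e\<in>(B - J) \<union> G. x e) = (\<Prod>e\<in>B - J. x e) * (\<Prod>e\<in>G. x e)"
      by (rule prod.union_disjoint) (use fin f G disj in auto)
    moreover have "(\<Prod>b\<in>B. x b) = (\<Prod>e\<in>B - J. x e) * (\<Prod>e\<in>J. x e)"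
      by (rule prod.subset_diff[OF JB fin(1)])
    moreover have "(\<Prod>e\<in>J. x e) \<noteq> 0" using x JB f by auto
    moreover have "(\<Prod>i\<in>J. lam / x i) = lam ^ card J / (\<Prod>e\<in>J. x e)"
      by (simp add: prod_dividef)
    ultimately show ?thesis unfolding p by simp
  qed
  have "(\<Sum>A\<in>{B - I..B \<union> F}. lam powi (- int (card (A \<inter> B))) * (\<Prod>e\<in>A. x e)) =
      (\<Sum>(G, J)\<in>Pow F \<times> Pow I.
        lam powi (- int (card (((B - J) \<union> G) \<inter> B))) * (\<Prod>e\<in>(B - J) \<union> G. x e))"
    using sum.reindex_bij_betw[OF bij, symmetric,
        of "\<lambda>A. lam powi (- int (card (A \<inter> B))) * (\<Prod>e\<in>A. x e)"]
    by (simp add: case_prod_unfold)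
  also have "\<dots> = (\<Sum>(G, J)\<in>Pow F \<times> Pow I.
      lam powi (- int (card B)) * (\<Prod>b\<in>B. x b) * ((\<Prod>e\<in>G. x e) * (\<Prod>i\<in>J. lam / x i)))"
    by (rule sum.cong) (auto intro!: summand)
  also have "\<dots> = lam powi (- int (card B)) * (\<Prod>b\<in>B. x b) *
      ((\<Sum>G\<in>Pow F. \<Prod>e\<in>G. x e) * (\<Sum>J\<in>Pow I. \<Prod>i\<in>J. lam / x i))"
    unfolding sum_product sum.cartesian_product
    by (simp only: sum_distrib_left case_prod_unfold)
  also have "(\<Sum>G\<in>Pow F. \<Prod>e\<in>G. x e) = (\<Prod>e\<in>F. x e + 1)"
    using prod_add[OF fin(2), of x "\<lambda>_. 1"] by simp
  also have "(\<Sum>J\<in>Pow I. \<Prod>i\<in>J. lam / x i) = (\<Prod>i\<in>I. lam / x i + 1)"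
    using prod_add[OF fI, of "\<lambda>i. lam / x i" "\<lambda>_. 1"] by simp
  finally show ?thesis by (simp add: mult.assoc)
qed

section \<open>The order as numerical positions\<close>

text \<open>Counting predecessors within \<open>E\<close> gives the positions. Numbers allow
  \<open>activity_weight\<close> to reverse the order on a part of \<open>E\<close>.\<close>

lemma strict_linear_order_rank_function:
  assumes "strict_linear_order_on E R" "finite E"
  obtains pos :: "'e \<Rightarrow> nat"
  where "\<forall>e\<in>E. \<forall>f\<in>E. (e, f) \<in> R \<longleftrightarrow> pos e < pos f" "inj_on pos E"
proof -
  have R: "trans R" "irrefl R" "total_on E R"
    using assms unfolding strict_linear_order_on_def by auto
  define pos where "pos e = card {f \<in> E. (f, e) \<in> R}" for e
  have less: "pos e < pos f" if "e \<in> E" "(e, f) \<in> R" for e f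
    unfolding pos_def
  proof (rule psubset_card_mono)
    \<comment> \<open>The inclusion is proper: \<open>e\<close> lies in the second set but, by
      irreflexivity, not in the first.\<close>
    show "{g \<in> E. (g, e) \<in> R} \<subset> {g \<in> E. (g, f) \<in> R}"
      using that transD[OF R(1)] irreflD[OF R(2)] by blast
  qed (use assms in simp)
  have tot: "e = f \<or> (e, f) \<in> R \<or> (f, e) \<in> R" if "e \<in> E" "f \<in> E" for e f
    using R(3) that unfolding total_on_def by blast
  show thesis
  proof (rule that[of pos])
    show "\<forall>e\<in>E. \<forall>f\<in>E. (e, f) \<in> R \<longleftrightarrow> pos e < pos f"
      using less tot by (metis less_asym less_irrefl)
    show "inj_on pos E"
      using less tot by (metis inj_onI less_irrefl)
  qed
qed

context semimatroid
begin

section \<open>Extension and exchange of bases\<close>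

lemma bases_central: "B \<in> bases C r \<Longrightarrow> B \<in> C"
  by (simp add: bases_iff independents_def)

lemma bases_rank: "B \<in> bases C r \<Longrightarrow> r B = total_rank C r"
  by (simp add: bases_iff independents_def)

text \<open>A maximal independent set between \<open>S\<close> and \<open>S \<union> B\<close> has
  full rank, since otherwise \<open>augment\<close> would add an element of
  \<open>B\<close>.\<close>

lemma independent_extend_basis:
  assumes S: "S \<in> independents C r" and B: "B \<in> bases C r"
  obtains B' where "B' \<in> bases C r" "S \<subseteq> B'" "B' \<subseteq> S \<union> B"
proof -
  let ?F = "{X \<in> independents C r. S \<subseteq> X \<and> X \<subseteq> S \<union> B}"
  have "?F \<subseteq> C" "S \<in> ?F" using S by (auto simp: independents_def)
  then obtain M where "maximal_in ?F M" by (rule central_in_maximal)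
  then have M: "M \<in> independents C r" "S \<subseteq> M" "M \<subseteq> S \<union> B"
    and max: "\<And>Y. Y \<in> ?F \<Longrightarrow> M \<subseteq> Y \<Longrightarrow> Y = M"
    unfolding maximal_in_def by auto
  have Mc: "M \<in> C" "r M = card M" "finite M"
    using M(1) central_finite unfolding independents_def by auto
  have "\<not> r M < r B"
  proof
    assume "r M < r B"
    then obtain e where e: "e \<in> B - M" "M \<union> {e} \<in> C" "r (M \<union> {e}) = r M + 1"
      using augment[OF Mc(1) bases_central[OF B]] by metis
    then have "M \<union> {e} \<in> ?F" using M Mc by (auto simp: independents_def)
    then show False using max e(1) by blast
  qed
  then have "card M = total_rank C r"
    using rank_le_total[OF Mc(1)] Mc(2) bases_rank[OF B] by simp
  then show thesis using that M unfolding bases_iff by blast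
qed

text \<open>Extending \<open>S \<union> {a}\<close> to a basis inside \<open>B \<union> {a}\<close>
  must lose exactly one element of \<open>B\<close>, by cardinality. Fixing \<open>S\<close>
  controls where the lost element lies.\<close>

lemma basis_exchange:
  assumes B: "B \<in> bases C r" and S: "S \<subseteq> B" "S \<union> {a} \<in> independents C r" and a: "a \<notin> B"
  obtains b where "b \<in> B - S" "(B - {b}) \<union> {a} \<in> bases C r"
proof -
  obtain B' where B': "B' \<in> bases C r" "S \<union> {a} \<subseteq> B'" "B' \<subseteq> (S \<union> {a}) \<union> B"
    using independent_extend_basis[OF S(2) B] .
  have fin: "finite B" "finite B'" using B B' bases_central central_finite by blast+
  have card: "card B' = card B" using B B' bases_iff by simp
  have "B' \<noteq> B" using B' a by blast
  then have "\<not> B \<subseteq> B'" using card_subset_eq[OF fin(2)] card by auto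
  then obtain b where b: "b \<in> B" "b \<notin> B'" by blast
  have "B' \<subseteq> (B - {b}) \<union> {a}" using B' S b by blast
  moreover have "card ((B - {b}) \<union> {a}) = card B'"
    using fin a b card card_Suc_Diff1[OF fin(1) b(1)] by simp
  ultimately have "B' = (B - {b}) \<union> {a}" using fin by (simp add: card_subset_eq)
  then show thesis using that b B' S by blast
qed

section \<open>Activities in terms of single exchanges\<close>

text \<open>Counterpart of \<open>fundamental_cocircuit_eq\<close>, so that both activities speak of
  the same exchanges. Removing \<open>f\<close> from \<open>B \<union> {e}\<close> leaves an
  independent set exactly when it destroys the only circuit there.\<close>

lemma fundamental_circuit_eq:
  assumes B: "B \<in> bases C r" and e: "e \<in> E - B" "B \<union> {e} \<in> C"
  shows "fundamental_circuit C r e B = {f \<in> B \<union> {e}. (B \<union> {e}) - {f} \<in> bases C r}"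
proof -
  define D where "D = fundamental_circuit C r e B"
  have D: "D \<in> circuits C r" "D \<subseteq> B \<union> {e}"
    using theI'[OF fundamental_circuit_ex1(1)[OF assms]]
    unfolding D_def fundamental_circuit_def by auto
  have uniq: "D' = D" if "D' \<in> circuits C r" "D' \<subseteq> B \<union> {e}" for D'
    using fundamental_circuit_ex1(1)[OF assms] D that by blast
  have fin: "finite B" using central_finite[OF bases_central[OF B]] .
  have "(B \<union> {e}) - {f} \<in> bases C r" if f: "f \<in> D" for f
  proof -
    have Xc: "(B \<union> {e}) - {f} \<in> C" by (rule central_down[OF e(2)]) blast
    have "(B \<union> {e}) - {f} \<in> independents C r"
    proof (rule ccontr)
      assume dep: "(B \<union> {e}) - {f} \<notin> independents C r"
      let ?F = "{D \<in> C - independents C r. D \<subseteq> (B \<union> {e}) - {f}}"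
      have "finite ?F" "(B \<union> {e}) - {f} \<in> ?F" using finite_central dep Xc by auto
      from finite_has_minimal2[OF this] obtain D' where
        D': "D' \<in> ?F" "\<forall>Y\<in>?F. Y \<subseteq> D' \<longrightarrow> D' = Y" by auto
      have "D' \<in> circuits C r"
        using D' unfolding circuits_def minimal_in_def by blast
      then have "D' = D" using uniq D' by blast
      then show False using D' f by blast
    qed
    moreover have "card ((B \<union> {e}) - {f}) = card B"
      using fin e f D by (auto simp: card_Diff_singleton)
    ultimately show ?thesis using B unfolding bases_iff by simp
  qed
  moreover have "f \<in> D" if "f \<in> B \<union> {e}" "(B \<union> {e}) - {f} \<in> bases C r" for f
  proof (rule ccontr)
    assume "f \<notin> D"
    then have "D \<subseteq> (B \<union> {e}) - {f}" using D by blast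
    then have "D \<in> independents C r"
      using independent_subset that(2) unfolding bases_iff by metis
    then show False using D(1) unfolding circuits_def minimal_in_def by blast
  qed
  ultimately show ?thesis using D(2) unfolding D_def by blast
qed

text \<open>In the fundamental circuit, comparing \<open>e\<close> with itself is vacuous, so only
  exchanges of some \<open>b\<close> in \<open>B\<close> for \<open>e\<close> remain.\<close>

lemma externally_active_iff:
  assumes B: "B \<in> bases C r"
    and pos: "\<forall>e\<in>E. \<forall>f\<in>E. (e, f) \<in> R \<longleftrightarrow> pos e < (pos f :: nat)"
  shows "e \<in> externally_active E C r R B \<longleftrightarrow> e \<in> E - B \<and> B \<union> {e} \<in> C \<and>
    (\<forall>b\<in>B. (B - {b}) \<union> {e} \<in> bases C r \<longrightarrow> pos e \<le> pos b)"
proof (cases "e \<in> E - B \<and> B \<union> {e} \<in> C")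
  case True
  have BE: "B \<subseteq> E" using central_subset[OF bases_central[OF B]] .
  have "(B \<union> {e}) - {b} = (B - {b}) \<union> {e}" if "b \<in> B" for b using True that by blast
  moreover have "(B \<union> {e}) - {e} = B" using True by blast
  moreover have "(b, e) \<in> R \<longleftrightarrow> pos b < pos e" if "b \<in> B \<union> {e}" for b
    using pos True BE that by blast
  ultimately show ?thesis
    using True B fundamental_circuit_eq[OF B, of e]
    unfolding externally_active_def order_minimal_def by (auto simp: not_less)
qed (auto simp: externally_active_def)

lemma internally_active_iff:
  assumes B: "B \<in> bases C r"
    and pos: "\<forall>e\<in>E. \<forall>f\<in>E. (e, f) \<in> R \<longleftrightarrow> pos e < (pos f :: nat)"
  shows "b \<in> internally_active E C r R B \<longleftrightarrow> b \<in> B \<and>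
    (\<forall>f\<in>E. (B - {b}) \<union> {f} \<in> bases C r \<longrightarrow> pos b \<le> pos f)"
proof (cases "b \<in> B")
  case True
  then have "b \<in> E" "(B - {b}) \<union> {b} = B" using central_subset[OF bases_central[OF B]] by auto
  then show ?thesis
    using True B pos fundamental_cocircuit_eq[OF B True]
    unfolding internally_active_def order_minimal_def by (auto simp: not_less)
qed (auto simp: internally_active_def)

section \<open>Bases optimal under single exchanges\<close>

text \<open>The local form of being a basis of minimal total weight.\<close>

definition exchange_optimal :: "('e \<Rightarrow> int) \<Rightarrow> 'e set \<Rightarrow> bool" where
  "exchange_optimal w B \<longleftrightarrow> B \<in> bases C r \<and>
    (\<forall>b\<in>B. \<forall>f\<in>E. (B - {b}) \<union> {f} \<in> bases C r \<longrightarrow> w b \<le> w f)"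

text \<open>A basis of minimal total weight qualifies, because an exchange changes the total by
  \<open>w f - w b\<close>.\<close>

lemma exchange_optimal_exists: "\<exists>B. exchange_optimal w B"
proof -
  have "bases C r \<subseteq> C" using bases_central by blast
  then have "finite (bases C r)" using finite_central finite_subset by blast
  from arg_min_if_finite[OF this bases_nonempty, of "\<lambda>B. \<Sum>b\<in>B. w b"]
  obtain B where B: "B \<in> bases C r"
    and min: "\<And>B'. B' \<in> bases C r \<Longrightarrow> (\<Sum>b\<in>B. w b) \<le> (\<Sum>b\<in>B'. w b)"
    by (meson not_le_imp_less)
  have "w b \<le> w f" if b: "b \<in> B" and f: "f \<in> E" "(B - {b}) \<union> {f} \<in> bases C r" for b f
  proof -
    have fin: "finite B" using central_finite[OF bases_central[OF B]] .
    have cards: "card ((B - {b}) \<union> {f}) = card B" using f B bases_iff by simp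
    \<comment> \<open>The case \<open>f = b\<close> stays allowed; any other \<open>f\<close> in
      \<open>B\<close> would make the exchanged set too small.\<close>
    have "f \<notin> B - {b}"
    proof
      assume "f \<in> B - {b}"
      then have "(B - {b}) \<union> {f} = B - {b}" by blast
      then show False using cards card_Diff1_less[OF fin b] by simp
    qed
    then have "(\<Sum>e\<in>(B - {b}) \<union> {f}. w e) = w f + (\<Sum>e\<in>B - {b}. w e)" using fin by simp
    moreover have "(\<Sum>e\<in>B. w e) = w b + (\<Sum>e\<in>B - {b}. w e)" using sum.remove[OF fin b] .
    ultimately show ?thesis using min[OF f(2)] by simp
  qed
  then show ?thesis using B unfolding exchange_optimal_def by blast
qed

text \<open>Let \<open>a\<close> be the lightest element of the symmetric difference. Exchanging it
  into the basis that lacks it removes some \<open>c\<close> of the symmetric difference. Optimality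
  and the choice of \<open>a\<close> give equal weights, yet \<open>a\<close> and \<open>c\<close>
  lie on opposite sides.\<close>

lemma exchange_optimal_unique:
  assumes opt: "exchange_optimal w B1" "exchange_optimal w B2" and inj: "inj_on w E"
  shows "B1 = B2"
proof (rule ccontr)
  assume neq: "B1 \<noteq> B2"
  let ?D = "(B1 - B2) \<union> (B2 - B1)"
  have b: "B1 \<in> bases C r" "B2 \<in> bases C r" using opt unfolding exchange_optimal_def by auto
  then have sub: "B1 \<subseteq> E" "B2 \<subseteq> E" using bases_central central_subset by blast+
  then have "finite ?D" "?D \<noteq> {}" using neq finite_ground by (auto dest: finite_subset)
  from arg_min_if_finite[OF this, of w]
  obtain a where a: "a \<in> ?D" and min: "\<And>c. c \<in> ?D \<Longrightarrow> w a \<le> w c"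
    by (meson not_le_imp_less)
  \<comment> \<open>Stated for variable \<open>B\<close> and \<open>B'\<close> because
    \<open>a\<close> may lie in either basis.\<close>
  have no: False if opt: "exchange_optimal w B'" and bas: "B \<in> bases C r" "B' \<in> bases C r"
    and aB: "a \<in> B - B'" and D: "B' - B \<subseteq> ?D" and sub: "B \<subseteq> E" "B' \<subseteq> E" for B B'
  proof -
    have "(B \<inter> B') \<union> {a} \<in> independents C r"
      by (rule independent_subset[of B]) (use bas aB in \<open>auto simp: bases_iff\<close>)
    \<comment> \<open>Keeping the common part fixed forces \<open>c\<close> outside
      \<open>B\<close>.\<close>
    then obtain c where c: "c \<in> B' - (B \<inter> B')" "(B' - {c}) \<union> {a} \<in> bases C r"
      using basis_exchange[OF bas(2), of "B \<inter> B'" a] aB by auto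
    have "w c \<le> w a" using opt c aB sub unfolding exchange_optimal_def by blast
    moreover have "w a \<le> w c" using min c D by blast
    ultimately have "a = c" using inj c(1) aB sub by (metis Diff_iff antisym inj_onD subsetD)
    then show False using c aB by blast
  qed
  from a show False
    using no[OF opt(2) b _ _ sub] no[OF opt(1) b(2,1) _ _ sub(2,1)] by blast
qed

section \<open>Activity intervals and optimality\<close>

text \<open>Negation puts \<open>A\<close> first and reverses its order; the \<open>- 1\<close>
  keeps weights on \<open>A\<close> strictly negative even at position 0.\<close>

definition activity_weight :: "('e \<Rightarrow> nat) \<Rightarrow> 'e set \<Rightarrow> 'e \<Rightarrow> int" where
  "activity_weight pos A e = (if e \<in> A then - 1 - int (pos e) else int (pos e))"

lemma inj_on_activity_weight: "inj_on pos E \<Longrightarrow> inj_on (activity_weight pos A) E"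
  unfolding inj_on_def activity_weight_def by (auto split: if_splits)

text \<open>If \<open>A \<inter> B\<close> had smaller rank, some \<open>a\<close> of
  \<open>A\<close> could replace some \<open>b\<close> outside \<open>A\<close>, lowering the
  weight. The equality feeds SR4 and later fixes the exponent of \<open>lam\<close>.\<close>

lemma exchange_optimal_rank:
  assumes opt: "exchange_optimal (activity_weight pos A) B" and A: "A \<in> C"
  shows "r A = r (A \<inter> B)"
proof (rule ccontr)
  assume neq: "r A \<noteq> r (A \<inter> B)"
  have B: "B \<in> bases C r" using opt unfolding exchange_optimal_def by blast
  have ind: "A \<inter> B \<in> independents C r"
    by (rule independent_subset[of B]) (use B in \<open>auto simp: bases_iff\<close>)
  have c: "A \<inter> B \<in> C" by (rule central_down[OF A]) blast
  have "r (A \<inter> B) < r A" using SR2[OF c A] neq by simp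
  then obtain a where a: "a \<in> A - (A \<inter> B)" "(A \<inter> B) \<union> {a} \<in> C"
      "r ((A \<inter> B) \<union> {a}) = r (A \<inter> B) + 1"
    using augment[OF c A] by metis
  then have "(A \<inter> B) \<union> {a} \<in> independents C r"
    using ind central_finite[OF c] unfolding independents_def by simp
  then obtain b where b: "b \<in> B - (A \<inter> B)" "(B - {b}) \<union> {a} \<in> bases C r"
    using basis_exchange[OF B, of "A \<inter> B" a] a(1) by blast
  have "a \<in> E" using a(1) central_subset[OF A] by blast
  then have "activity_weight pos A b \<le> activity_weight pos A a"
    using opt b unfolding exchange_optimal_def by blast
  then show False using a(1) b(1) unfolding activity_weight_def by auto
qed

text \<open>Consider exchanging \<open>b\<close> for \<open>f\<close>. With both outside
  \<open>A\<close>, optimality is the condition for \<open>b\<close> to be internally active; with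
  both in \<open>A\<close>, it is the one for \<open>f\<close> to be externally active. With only
  \<open>b\<close> in \<open>A\<close> it is automatic, and with only \<open>f\<close> in
  \<open>A\<close> it forbids the exchange.\<close>

lemma mem_activity_interval_iff:
  assumes B: "B \<in> bases C r" and A: "A \<in> C"
    and pos: "\<forall>e\<in>E. \<forall>f\<in>E. (e, f) \<in> R \<longleftrightarrow> pos e < (pos f :: nat)"
    and inj: "inj_on pos E"
  shows "A \<in> {B - internally_active E C r R B..B \<union> externally_active E C r R B} \<longleftrightarrow>
    exchange_optimal (activity_weight pos A) B"
proof -
  note EA = externally_active_iff[OF B pos] and IA = internally_active_iff[OF B pos]
  have BE: "B \<subseteq> E" and AE: "A \<subseteq> E" using central_subset bases_central B A by blast+
  show ?thesis
  proof
    assume A_int: "A \<in> {B - internally_active E C r R B..B \<union> externally_active E C r R B}"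
    have IA': "b \<in> internally_active E C r R B" if "b \<in> B - A" for b using A_int that by auto
    have EA': "f \<in> externally_active E C r R B" if "f \<in> A - B" for f using A_int that by auto
    have "activity_weight pos A b \<le> activity_weight pos A f"
      if b: "b \<in> B" and f: "f \<in> E" "(B - {b}) \<union> {f} \<in> bases C r" for b f
    proof (cases "f \<in> B")
      case True
      have "f = b"
      proof (rule ccontr)
        assume "f \<noteq> b"
        then have "(B - {b}) \<union> {f} \<subset> B" using True b by blast
        then have "card ((B - {b}) \<union> {f}) < card B"
          by (rule psubset_card_mono[OF central_finite[OF bases_central[OF B]]])
        then show False using f B unfolding bases_iff by simp
      qed
      then show ?thesis by simp
    next
      case fB: False
      have leaves: "pos b \<le> pos f" if "b \<notin> A" using IA' that b f IA by blast
      have enters: "pos f \<le> pos b" if "f \<in> A" using EA' that fB b f EA by blast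
      \<comment> \<open>This excludes \<open>b\<close> outside \<open>A\<close> with
        \<open>f\<close> in \<open>A\<close>, where \<open>leaves\<close> and \<open>enters\<close>
        would force equal positions.\<close>
      have "pos b \<noteq> pos f" using inj b f(1) fB BE by (metis inj_onD subsetD)
      then show ?thesis using leaves enters unfolding activity_weight_def by auto
    qed
    then show "exchange_optimal (activity_weight pos A) B"
      using B unfolding exchange_optimal_def by blast
  next
    assume opt: "exchange_optimal (activity_weight pos A) B"
    then have w: "activity_weight pos A b \<le> activity_weight pos A f"
      if "b \<in> B" "f \<in> E" "(B - {b}) \<union> {f} \<in> bases C r" for b f
      using that unfolding exchange_optimal_def by blast
    \<comment> \<open>Centrality of the union supplies the clause
      \<open>B \<union> {e} \<in> C\<close> of external activity.\<close>
    have union: "A \<union> B \<in> C"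
      by (rule SR4[OF A bases_central[OF B] exchange_optimal_rank[OF opt A]])
    have "e \<in> externally_active E C r R B" if e: "e \<in> A - B" for e
    proof -
      have "B \<union> {e} \<in> C" by (rule central_down[OF union]) (use e in blast)
      \<comment> \<open>A \<open>b\<close> outside \<open>A\<close> would have nonnegative weight,
        above the negative weight of \<open>e\<close>. So \<open>b\<close> is in \<open>A\<close>,
        where the weights reverse positions.\<close>
      moreover have "pos e \<le> pos b" if "b \<in> B" "(B - {b}) \<union> {e} \<in> bases C r" for b
        using w[OF that(1) _ that(2)] e AE unfolding activity_weight_def
        by (auto split: if_splits)
      ultimately show ?thesis using e AE unfolding EA by blast
    qed
    moreover have "b \<in> internally_active E C r R B" if b: "b \<in> B - A" for b
    proof -
      have "pos b \<le> pos f" if "f \<in> E" "(B - {b}) \<union> {f} \<in> bases C r" for f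
        using w[OF _ that] b unfolding activity_weight_def by (auto split: if_splits)
      then show ?thesis using b unfolding IA by blast
    qed
    ultimately show "A \<in> {B - internally_active E C r R B..B \<union> externally_active E C r R B}"
      by auto
  qed
qed

section \<open>Centrality of the intervals\<close>

text \<open>Central sets containing \<open>B\<close> have the rank of \<open>B\<close>, so SR4 glues
  \<open>B \<union> S\<close> and \<open>B \<union> {e}\<close> along \<open>B\<close>.\<close>

lemma basis_union_central:
  assumes B: "B \<in> bases C r" and S: "\<And>e. e \<in> S \<Longrightarrow> B \<union> {e} \<in> C"
  shows "B \<union> S \<in> C"
proof -
  have "S \<subseteq> E" using S central_subset by blast
  then have "finite S" using finite_ground finite_subset by blast
  then show ?thesis using S
  proof (induction S rule: finite_induct)
    case empty
    then show ?case using bases_central[OF B] by simp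
  next
    case (insert e S)
    have IH: "B \<union> S \<in> C" and e: "B \<union> {e} \<in> C" using insert by auto
    have int: "(B \<union> S) \<inter> (B \<union> {e}) = B" using insert by blast
    have "r (B \<union> S) = r ((B \<union> S) \<inter> (B \<union> {e}))"
      unfolding int using rank_le_total[OF IH] bases_rank[OF B] SR2[OF bases_central[OF B] IH]
      by auto
    from SR4[OF IH e this] show ?case by (simp add: Un_ac)
  qed
qed

lemma activity_interval_central:
  assumes "B \<in> bases C r" "A \<subseteq> B \<union> externally_active E C r R B"
  shows "A \<in> C"
proof -
  have "B \<union> externally_active E C r R B \<in> C"
    by (rule basis_union_central[OF assms(1)]) (auto simp: externally_active_def)
  then show ?thesis using assms(2) by (rule central_down)
qed

end

section \<open>Summation over the partition\<close>

theorem theorem2p3: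
  fixes E :: "'e set" and C :: "'e set set" and r :: "'e set \<Rightarrow> nat"
    and R :: "('e \<times> 'e) set"
    and lam :: "'a::field" and x :: "'e \<Rightarrow> 'a"
  assumes "semimatroid E C r"
    and "strict_linear_order_on E R"
    and "lam \<noteq> 0"
    and "\<And>e. e \<in> E \<Longrightarrow> x e \<noteq> 0"
  shows "multivariate_tutte C r lam x =
    lam powi (- int (total_rank C r)) *
      (\<Sum>B\<in>bases C r.
        (\<Prod>b\<in>B. x b) *
        (\<Prod>e\<in>externally_active E C r R B. x e + 1) *
        (\<Prod>i\<in>internally_active E C r R B. lam / x i + 1))"
proof -
  interpret semimatroid E C r by fact
  obtain pos :: "'e \<Rightarrow> nat"
    where pos: "\<forall>e\<in>E. \<forall>f\<in>E. (e, f) \<in> R \<longleftrightarrow> pos e < pos f" and inj: "inj_on pos E"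
    using strict_linear_order_rank_function[OF assms(2) finite_ground] by blast
  let ?EA = "externally_active E C r R" and ?IA = "internally_active E C r R"
  let ?I = "\<lambda>B. {B - ?IA B..B \<union> ?EA B}"
  let ?g = "\<lambda>A. lam powi (- int (r A)) * (\<Prod>e\<in>A. x e)"
  have finb: "finite (bases C r)"
    using bases_central finite_central by (meson finite_subset subsetI)
  have int_iff: "A \<in> ?I B \<longleftrightarrow> exchange_optimal (activity_weight pos A) B"
    if "B \<in> bases C r" "A \<in> C" for A B
    using mem_activity_interval_iff[OF that pos inj] .
  have central: "A \<in> C" if "B \<in> bases C r" "A \<in> ?I B" for A B
    using activity_interval_central that by auto
  have cover: "C = (\<Union>B\<in>bases C r. ?I B)"
  proof
    show "C \<subseteq> (\<Union>B\<in>bases C r. ?I B)"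
    proof
      fix A assume A: "A \<in> C"
      obtain B where "exchange_optimal (activity_weight pos A) B"
        using exchange_optimal_exists by blast
      moreover from this have "B \<in> bases C r" unfolding exchange_optimal_def by blast
      ultimately show "A \<in> (\<Union>B\<in>bases C r. ?I B)" using int_iff A by blast
    qed
  qed (use central in blast)
  \<comment> \<open>A common member \<open>A\<close> determines one injective weight, for which both
    bases would be optimal.\<close>
  have disj: "?I B \<inter> ?I B' = {}" if B: "B \<in> bases C r" "B' \<in> bases C r" "B \<noteq> B'" for B B'
  proof -
    have False if "A \<in> ?I B" "A \<in> ?I B'" for A
      using int_iff central that B exchange_optimal_unique inj_on_activity_weight[OF inj] by metis
    then show ?thesis by blast
  qed
  have "multivariate_tutte C r lam x = (\<Sum>A\<in>(\<Union>B\<in>bases C r. ?I B). ?g A)"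
    unfolding multivariate_tutte_def using cover by simp
  also have "\<dots> = (\<Sum>B\<in>bases C r. \<Sum>A\<in>?I B. ?g A)"
  proof (rule sum.UNION_disjoint[OF finb])
    show "\<forall>B\<in>bases C r. finite (?I B)"
      using central finite_central by (meson finite_subset subsetI)
  qed (use disj in blast)
  also have "\<dots> = (\<Sum>B\<in>bases C r. lam powi (- int (total_rank C r)) *
      ((\<Prod>b\<in>B. x b) * (\<Prod>e\<in>?EA B. x e + 1) * (\<Prod>i\<in>?IA B. lam / x i + 1)))"
  proof (rule sum.cong[OF refl])
    fix B assume B: "B \<in> bases C r"
    \<comment> \<open>\<open>A\<close> has the rank of \<open>A \<inter> B\<close>, which is
      independent as a subset of \<open>B\<close>.\<close>
    have "?g A = lam powi (- int (card (A \<inter> B))) * (\<Prod>e\<in>A. x e)" if A: "A \<in> ?I B" for A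
    proof -
      have "r A = r (A \<inter> B)"
        using exchange_optimal_rank int_iff[OF B] central[OF B] A by blast
      moreover have "A \<inter> B \<in> independents C r"
        by (rule independent_subset[of B]) (use B in \<open>auto simp: bases_iff\<close>)
      ultimately show ?thesis unfolding independents_def by simp
    qed
    then have "(\<Sum>A\<in>?I B. ?g A) =
        (\<Sum>A\<in>?I B. lam powi (- int (card (A \<inter> B))) * (\<Prod>e\<in>A. x e))"
      by (rule sum.cong[OF refl])
    also have "\<dots> = lam powi (- int (card B)) *
        ((\<Prod>b\<in>B. x b) * (\<Prod>e\<in>?EA B. x e + 1) * (\<Prod>i\<in>?IA B. lam / x i + 1))"
    proof (rule sum_activity_interval)
      show "finite B" using central_finite[OF bases_central[OF B]] .
      show "finite (?EA B)" using finite_ground unfolding externally_active_def by simp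
      show "?EA B \<inter> B = {}" unfolding externally_active_def by blast
      show "?IA B \<subseteq> B" unfolding internally_active_def by blast
      show "x b \<noteq> 0" if "b \<in> B" for b
        using assms(4) that central_subset[OF bases_central[OF B]] by blast
    qed fact
    finally show "(\<Sum>A\<in>?I B. ?g A) = lam powi (- int (total_rank C r)) *
        ((\<Prod>b\<in>B. x b) * (\<Prod>e\<in>?EA B. x e + 1) * (\<Prod>i\<in>?IA B. lam / x i + 1))"
      using B by (simp add: bases_iff)
  qed
  finally show ?thesis by (simp add: sum_distrib_left)
qed

end
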